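(* Let $x>1$ be real, let $s\geq 2$, $m\ge1$ be fixed integers, and let $a$ be a fixed real number with $-1<a<0$. Then \begin{align*} H_1^{(s)}(x;\phi_{s+a}) &= -\frac{1}{2(1+a)\zeta(s+a+1)}\,x^{1+a}-\frac{\zeta(-a)}{2\zeta(s)}+O_{s,a}\!\left(x^{a}\right),\\ H_1^{(s)}(x;\psi_{s+a}) &= -\frac{\zeta(s+a+1)}{2(1+a)\zeta(2s+2a+2)}\,x^{1+a}-\frac{\zeta(-a)\zeta(s)}{2\zeta(2s)}+O_{s,a}\!\left(x^{a}\right),\\ H_{2m}^{(s)}(x;\phi_{s+a}) &= \frac{B_{2m}\zeta(2ms+a+1)}{(1+a)\zeta(s+a+1)^2}\,x^{1+a}+\frac{B_{2m}\zeta(-a)\zeta(2ms)}{\zeta(s)^2}+O_{a,m,s}\!\left(x^{a}\right),\\ H_{2m}^{(s)}(x;\psi_{s+a}) &= \frac{B_{2m}\zeta(2ms+a+1)}{(1+a)\zeta(2s+2a+2)}\,x^{1+a}+\frac{B_{2m}\zeta(-a)\zeta(2ms)}{\zeta(2s)}+O_{a,m,s}\!\left(x^{a}\right). \end{align*}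
   Context: $*$ denotes Dirichlet convolution, $\mu$ the Möbius function, $\zeta$ the Riemann zeta function. $B_n(t)$ are the Bernoulli polynomials, defined by $\frac{te^{xt}}{e^t-1}=\sum_{n\ge0}B_n(x)\frac{t^n}{n!}$, and $B_n=B_n(0)$. For real $b$, $\mathrm{id}_b(n)=n^b$, $\phi_b=\mathrm{id}_b*\mu$ and $\psi_b=\mathrm{id}_b*|\mu|$. For integers $s,m\ge1$ and an arithmetic function $f$, define $$H_m^{(s)}(x;f)=\sum_{k\le x}\frac{1}{k^s}\sum_{j=0}^{k^s-1}B_m\!\left(\frac{j}{k^s}\right)\sum_{\substack{d\mid k\\ d^s\mid j}}(f*\mu)(d).$$ *)

theory Defs
  imports
    "HOL-Complex_Analysis.Complex_Analysis"
    "HOL-Computational_Algebra.Computational_Algebra"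
begin

text \<open>
  The value at \<open>z\<close> of the analytic continuation of the Dirichlet series
  to some punctured half-plane containing \<open>z\<close>. Such half-planes are nested, so for
  \<open>z \<noteq> 1\<close> the value depends neither on the half-plane nor on the continuation (lemma
  \<open>zeta_eqI\<close>). The value at the pole \<open>z = 1\<close> is unspecified.
\<close>

definition zeta :: "complex \<Rightarrow> complex" where
  "zeta z = (THE v. \<exists>c f. c < Re z \<and> f holomorphic_on ({w. c < Re w} - {1}) \<and>
      (\<forall>w. Re w > 1 \<longrightarrow> (\<lambda>n. 1 / of_nat (Suc n) powr w) sums f w) \<and> v = f z)"

lemma zeta_eqI:
  assumes "z \<noteq> 1" "c < Re z"
    and "f holomorphic_on ({w. c < Re w} - {1})"
    and "\<And>w. Re w > 1 \<Longrightarrow> (\<lambda>n. 1 / of_nat (Suc n) powr w) sums f w"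
  shows "zeta z = f z"
  unfolding zeta_def
proof (rule the_equality)
  show "\<exists>c f'. c < Re z \<and> f' holomorphic_on ({w. c < Re w} - {1}) \<and>
      (\<forall>w. Re w > 1 \<longrightarrow> (\<lambda>n. 1 / of_nat (Suc n) powr w) sums f' w) \<and> f z = f' z"
    using assms by blast
next
  fix v
  assume "\<exists>c f'. c < Re z \<and> f' holomorphic_on ({w. c < Re w} - {1}) \<and>
      (\<forall>w. Re w > 1 \<longrightarrow> (\<lambda>n. 1 / of_nat (Suc n) powr w) sums f' w) \<and> v = f' z"
  then obtain d g where g: "d < Re z" "g holomorphic_on ({w. d < Re w} - {1})"
      "\<And>w. Re w > 1 \<Longrightarrow> (\<lambda>n. 1 / of_nat (Suc n) powr w) sums g w" "v = g z"
    by blast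
  define b where "b = max c d"
  define D where "D = {w. b < Re w} - {1 :: complex}"
  have "connected D" unfolding D_def
    by (intro connected_open_delete convex_connected open_halfspace_Re_gt convex_halfspace_Re_gt)
       auto
  moreover have "open D" unfolding D_def
    by (intro open_delete open_halfspace_Re_gt)
  moreover have "{w. max 1 b < Re w} \<noteq> {}"
    by (auto intro!: exI[of _ "of_real (max 1 b + 1)"])
  moreover have "f w = g w" if "w \<in> {w. max 1 b < Re w}" for w
    using that assms(4)[of w] g(3)[of w] sums_unique2 by simp blast
  moreover have "f holomorphic_on D" "g holomorphic_on D"
    by (rule holomorphic_on_subset[OF assms(3)] holomorphic_on_subset[OF g(2)];
        auto simp: D_def b_def)+
  moreover have "{w. max 1 b < Re w} \<subseteq> D" "z \<in> D"
    using assms(1,2) g(1) by (auto simp: D_def b_def)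
  ultimately have "f z = g z"
    using analytic_continuation_open[OF open_halfspace_Re_gt[of "max 1 b"], of D f g z] by blast
  thus "v = f z" using g(4) by simp
qed

definition bernoulli_poly :: "nat \<Rightarrow> real \<Rightarrow> real" where
  "bernoulli_poly n x = fact n * fps_nth (fps_X * fps_exp x / (fps_exp 1 - 1)) n"

text \<open>The quotient is exact, although the denominator has constant coefficient \<open>0\<close>.\<close>

lemma bernoulli_poly_generating_function:
  "Abs_fps (\<lambda>n. bernoulli_poly n x / fact n) * (fps_exp 1 - 1) = fps_X * fps_exp x"
proof -
  have nz: "fps_exp 1 - 1 \<noteq> (0 :: real fps)"
    by (auto simp: fps_eq_iff intro!: exI[of _ 1])
  have "subdegree (fps_exp 1 - 1 :: real fps) = 1"
    by (intro subdegreeI) auto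
  moreover have "subdegree (fps_X * fps_exp x) = 1"
    by (intro subdegreeI) auto
  ultimately have "(fps_exp 1 - 1) dvd (fps_X * fps_exp x)"
    using nz by (subst fps_dvd_iff) auto
  moreover have "Abs_fps (\<lambda>n. bernoulli_poly n x / fact n) = fps_X * fps_exp x / (fps_exp 1 - 1)"
    by (simp add: fps_eq_iff bernoulli_poly_def)
  ultimately show ?thesis by simp
qed

definition bernoulli :: "nat \<Rightarrow> real" where
  "bernoulli n = bernoulli_poly n 0"

text \<open>Arithmetic functions have type \<open>nat \<Rightarrow> real\<close>; their value at \<open>0\<close> is irrelevant.\<close>

definition dirichlet_conv :: "(nat \<Rightarrow> real) \<Rightarrow> (nat \<Rightarrow> real) \<Rightarrow> nat \<Rightarrow> real" where
  "dirichlet_conv f g n = (\<Sum>d | d dvd n. f d * g (n div d))"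

definition moebius_mu :: "nat \<Rightarrow> real" where
  "moebius_mu n = (if squarefree n then (- 1) ^ card (prime_factors n) else 0)"

definition id_pow :: "real \<Rightarrow> nat \<Rightarrow> real" where
  "id_pow b n = real n powr b"

definition phi :: "real \<Rightarrow> nat \<Rightarrow> real" where
  "phi b = dirichlet_conv (id_pow b) moebius_mu"

definition psi :: "real \<Rightarrow> nat \<Rightarrow> real" where
  "psi b = dirichlet_conv (id_pow b) (\<lambda>n. \<bar>moebius_mu n\<bar>)"

definition H :: "nat \<Rightarrow> nat \<Rightarrow> real \<Rightarrow> (nat \<Rightarrow> real) \<Rightarrow> real" where
  "H s m x f =
    (\<Sum>k | 1 \<le> k \<and> real k \<le> x. 1 / real k ^ s *
      (\<Sum>j<k ^ s. bernoulli_poly m (real j / real (k ^ s)) *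
        (\<Sum>d | d dvd k \<and> d ^ s dvd j. dirichlet_conv f moebius_mu d)))"

end

theory Submission
  imports Defs
begin

text \<open>
  The multiplication formula \<open>\<Sum>i<N. B\<^sub>m(i/N) = N\<^bsup>1-m\<^esup> B\<^sub>m\<close> collapses the sum over \<open>j\<close>, so that
  \<open>H s m x f\<close> is \<open>B\<^sub>m\<close> times the summatory function of the convolution of
  \<open>(f * \<mu>) \<cdot> id\<^bsub>-s\<^esub>\<close> with \<open>id\<^bsub>-ms\<^esub>\<close>. For \<open>f = id\<^bsub>s+a\<^esub> * M\<close>, where \<open>M\<close> is \<open>\<mu>\<close> or \<open>\<bar>\<mu>\<bar>\<close>, this
  convolution is \<open>id\<^sub>a * g\<close> with \<open>g = (M \<cdot> id\<^bsub>-s\<^esub>) * (\<mu> \<cdot> id\<^bsub>-s\<^esub>) * id\<^bsub>-ms\<^esub>\<close>. The Dirichlet series of \<open>g\<close>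
  converges absolutely at \<open>a\<close> because \<open>s + a > 1\<close>, so summing
  \<open>(\<Sum>u\<le>y. u\<^sup>a) = y\<^bsup>1+a\<^esup> / (1 + a) + \<zeta>(-a) + O(y\<^sup>a)\<close> against \<open>g v\<close> at \<open>y = x / v\<close> gives the two main
  terms, with the values of that series at \<open>1 + a\<close> and \<open>0\<close>, and the error \<open>O(x\<^sup>a)\<close>.
\<close>

subsection \<open>Bernoulli polynomials\<close>

text \<open>With \<open>E = fps_exp (1 / N)\<close>, the generating functions at the points
  \<open>i / N\<close> form a geometric series in \<open>E\<close> with sum
  \<open>fps_X / (E - 1)\<close>. This is \<open>N\<close> times the generating function at 0 with
  \<open>fps_X\<close> scaled by \<open>1 / N\<close>; comparing coefficients of degree
  \<open>m\<close> gives the claim.\<close>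

lemma bernoulli_poly_multiplication:
  assumes "N > 0"
  shows "(\<Sum>i<N. bernoulli_poly m (real i / real N)) = bernoulli m * real N / real N ^ m"
proof -
  define c where "c = 1 / real N"
  define F :: "real \<Rightarrow> real fps" where "F x = Abs_fps (\<lambda>n. bernoulli_poly n x / fact n)" for x
  define E where "E = fps_exp c"
  define L where "L = fps_const c * fps_X"
  have nz: "fps_exp b - 1 \<noteq> (0 :: real fps)" if "b \<noteq> 0" for b
    using that by (auto simp: fps_eq_iff intro!: exI[of _ 1])
  have F: "F x * (fps_exp 1 - 1) = fps_X * fps_exp x" for x
    unfolding F_def by (rule bernoulli_poly_generating_function)
  have EN: "E ^ N = fps_exp 1" and Ei: "E ^ i = fps_exp (real i / real N)" for i
    using assms by (simp_all add: E_def c_def fps_exp_power_mult)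
  have "(\<Sum>i<N. F (real i / real N)) * (E - 1) * (fps_exp 1 - 1)
      = (\<Sum>i<N. F (real i / real N) * (fps_exp 1 - 1)) * (E - 1)"
    unfolding sum_distrib_right by (intro sum.cong refl) (simp only: mult_ac)
  also have "\<dots> = fps_X * ((E - 1) * (\<Sum>i<N. E ^ i))"
    unfolding F Ei sum_distrib_left sum_distrib_right
    by (intro sum.cong refl) (simp only: mult_ac)
  also have "\<dots> = fps_X * (fps_exp 1 - 1)"
    by (simp only: power_diff_1_eq [symmetric] EN)
  finally have 1: "(\<Sum>i<N. F (real i / real N)) * (E - 1) = fps_X"
    using nz[of 1] by simp
  have "(F 0 oo L) * (E - 1) = (F 0 * (fps_exp 1 - 1)) oo L"
    by (subst fps_compose_mult_distrib)
       (auto simp: L_def E_def fps_compose_sub_distrib)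
  also have "\<dots> = L"
    by (simp add: F L_def)
  finally have "fps_const (real N) * (F 0 oo L) * (E - 1) = fps_const (real N) * L"
    by (simp add: mult.assoc)
  also have "\<dots> = fps_X"
    using assms by (simp add: L_def c_def flip: mult.assoc)
  finally have "(\<Sum>i<N. F (real i / real N)) * (E - 1) = fps_const (real N) * (F 0 oo L) * (E - 1)"
    using 1 by simp
  hence "(\<Sum>i<N. F (real i / real N)) = fps_const (real N) * (F 0 oo L)"
    using nz[of c] assms by (simp add: E_def c_def)
  hence "fps_nth (\<Sum>i<N. F (real i / real N)) m = fps_nth (fps_const (real N) * (F 0 oo L)) m"
    by simp
  hence "(\<Sum>i<N. bernoulli_poly m (real i / real N)) / fact m = real N * (c ^ m * (bernoulli m / fact m))"
    by (simp add: F_def L_def fps_sum_nth bernoulli_def sum_divide_distrib)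
  thus ?thesis
    by (simp add: c_def field_simps)
qed

text \<open>In the generating identity at 0, degree 1 says that the Bernoulli number of index 0 is
  1, and degree 2 that half of it plus \<open>bernoulli 1\<close> vanishes.\<close>

lemma bernoulli_1: "bernoulli 1 = - 1 / 2"
proof -
  have *: "fps_nth (Abs_fps (\<lambda>n. bernoulli_poly n 0 / fact n) * (fps_exp 1 - 1)) n
         = fps_nth (fps_X * fps_exp (0::real)) n" for n
    by (simp only: bernoulli_poly_generating_function)
  show ?thesis
    using *[of 1] *[of 2] unfolding bernoulli_def
    by (simp add: fps_mult_nth numeral_2_eq_2)
qed

section \<open>Reduction of \<open>H\<close> to a summatory function\<close>

text \<open>After the sums over \<open>j\<close> and \<open>d\<close> are exchanged, write
  \<open>k = d * e\<close>. The multiples of \<open>d ^ s\<close> below \<open>k ^ s\<close> are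
  \<open>j = d ^ s * i\<close> with \<open>i < e ^ s\<close>, and
  \<open>j / k ^ s = i / e ^ s\<close>. The multiplication formula with \<open>N = e ^ s\<close>,
  divided by \<open>k ^ s\<close>, leaves the weights \<open>d powr (- s)\<close> and
  \<open>e powr (- (m * s))\<close>.\<close>

lemma H_eq_sum_dirichlet_conv:
  "H s m x f = bernoulli m * (\<Sum>k | 1 \<le> k \<and> real k \<le> x. dirichlet_conv
     (\<lambda>d. dirichlet_conv f moebius_mu d * real d powr (- real s)) (id_pow (- real (m * s))) k)"
proof -
  define h where "h = dirichlet_conv f moebius_mu"
  have "1 / real k ^ s * (\<Sum>j<k ^ s. bernoulli_poly m (real j / real (k ^ s)) *
          (\<Sum>d | d dvd k \<and> d ^ s dvd j. h d)) =
        bernoulli m * dirichlet_conv (\<lambda>d. h d * real d powr (- real s)) (id_pow (- real (m * s))) k"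
    if k: "k > 0" for k :: nat
  proof -
    have fin: "finite {d. d dvd k}"
      using k by simp
    have inner: "(\<Sum>j | j < k ^ s \<and> d ^ s dvd j. bernoulli_poly m (real j / real (k ^ s))) / real k ^ s
        = bernoulli m * (real d powr (- real s) * id_pow (- real (m * s)) (k div d))"
      if d: "d dvd k" for d
    proof -
      obtain e where e: "k = d * e"
        using d by blast
      with k have pos: "d > 0" "e > 0"
        by auto
      have "(\<Sum>j | j < k ^ s \<and> d ^ s dvd j. bernoulli_poly m (real j / real (k ^ s)))
          = (\<Sum>i<e ^ s. bernoulli_poly m (real i / real (e ^ s)))"
        by (rule sum.reindex_bij_witness[of _ "\<lambda>i. d ^ s * i" "\<lambda>j. j div d ^ s"])
           (use pos in \<open>auto simp: e power_mult_distrib\<close>)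
      also have "\<dots> = bernoulli m * real (e ^ s) / real (e ^ s) ^ m"
        using pos by (intro bernoulli_poly_multiplication) auto
      also have "\<dots> / real k ^ s = bernoulli m * (inverse (real d ^ s) * inverse (real e ^ (m * s)))"
        using pos by (simp add: e power_mult_distrib field_simps flip: power_mult)
      also have "real d ^ s = real d powr real s"
        using pos by (simp add: powr_realpow)
      also have "real e ^ (m * s) = real e powr real (m * s)"
        using pos by (simp only: powr_realpow of_nat_0_less_iff)
      finally show ?thesis
        using pos by (simp add: e id_pow_def powr_minus)
    qed
    have "(\<Sum>j<k ^ s. bernoulli_poly m (real j / real (k ^ s)) *
             (\<Sum>d | d dvd k \<and> d ^ s dvd j. h d))
        = (\<Sum>j<k ^ s. \<Sum>d | d dvd k \<and> d ^ s dvd j. bernoulli_poly m (real j / real (k ^ s)) * h d)"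
      by (simp add: sum_distrib_left)
    also have "\<dots> = (\<Sum>d | d dvd k. \<Sum>j | j < k ^ s \<and> d ^ s dvd j.
                       bernoulli_poly m (real j / real (k ^ s)) * h d)"
      using sum.swap_restrict[OF finite_lessThan[of "k ^ s"] fin,
          of "\<lambda>j d. bernoulli_poly m (real j / real (k ^ s)) * h d" "\<lambda>j d. d ^ s dvd j"]
      by simp
    finally have "1 / real k ^ s * (\<Sum>j<k ^ s. bernoulli_poly m (real j / real (k ^ s)) *
             (\<Sum>d | d dvd k \<and> d ^ s dvd j. h d))
         = (\<Sum>d | d dvd k. h d * ((\<Sum>j | j < k ^ s \<and> d ^ s dvd j.
                       bernoulli_poly m (real j / real (k ^ s))) / real k ^ s))"
      by (simp add: sum_distrib_left sum_divide_distrib mult_ac)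
    also have "\<dots> = (\<Sum>d | d dvd k. bernoulli m *
        (h d * real d powr (- real s) * id_pow (- real (m * s)) (k div d)))"
      by (intro sum.cong refl, subst inner) (auto simp: mult_ac)
    finally show ?thesis
      by (simp add: dirichlet_conv_def sum_distrib_left)
  qed
  thus ?thesis
    unfolding H_def h_def by (simp add: sum_distrib_left)
qed

subsection \<open>The zeta function in the right half-plane\<close>

text \<open>
  The term \<open>k\<^bsup>-w\<^esup> - \<integral> t\<^bsup>-w\<^esup> dt\<close> over \<open>[k, k + 1]\<close> with \<open>k = n + 1\<close>. It is \<open>O(k\<^bsup>-Re w-1\<^esup>)\<close>, so the
  series converges for \<open>Re w > 0\<close> and continues \<open>\<zeta>(w) - 1 / (w - 1)\<close>.
\<close>

definition zeta_term :: "nat \<Rightarrow> complex \<Rightarrow> complex" where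
  "zeta_term n w = of_nat (Suc n) powr (- w) -
     (of_nat (Suc (Suc n)) powr (1 - w) - of_nat (Suc n) powr (1 - w)) / (1 - w)"

text \<open>Up to sign, \<open>zeta_term n w\<close> is the remainder of the first-order Taylor
  expansion of \<open>z powr (1 - w) / (1 - w)\<close> from \<open>n + 1\<close> to
  \<open>n + 2\<close>. The second derivative \<open>- w * z powr (- w - 1)\<close> is largest in
  modulus at the left end of the segment.\<close>

lemma norm_zeta_term_le:
  assumes "Re w > 0" "w \<noteq> 1"
  shows "cmod (zeta_term n w) \<le> cmod w * real (Suc n) powr (- Re w - 1)"
proof -
  let ?S = "closed_segment (of_nat (Suc n)) (of_nat (Suc (Suc n))) :: complex set"
  define f where "f = (\<lambda>(i :: nat) z. if i = 0 then z powr (1 - w) / (1 - w)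
     else if i = 1 then z powr (- w) else - w * z powr (- w - 1) :: complex)"
  have S: "z \<in> \<real> \<and> Re z \<ge> real (Suc n)" if "z \<in> ?S" for z
  proof -
    from that obtain u where u: "0 \<le> u" "z = (1 - u) *\<^sub>R of_nat (Suc n) + u *\<^sub>R of_nat (Suc (Suc n))"
      by (auto simp: closed_segment_def)
    have "z = of_real (real (Suc n) + u)"
      unfolding u(2) by (auto simp: complex_eq_iff algebra_simps)
    with u(1) show ?thesis
      by simp
  qed
  have nonpos: "z \<notin> \<real>\<^sub>\<le>\<^sub>0" if "z \<in> ?S" for z
    using S[OF that] by (auto simp: complex_nonpos_Reals_iff)
  have "cmod (f 0 (of_nat (Suc (Suc n))) -
      (\<Sum>i\<le>1. f i (of_nat (Suc n)) * (of_nat (Suc (Suc n)) - of_nat (Suc n)) ^ i / fact i))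
    \<le> (cmod w * real (Suc n) powr (- Re w - 1)) *
        cmod (of_nat (Suc (Suc n)) - of_nat (Suc n)) ^ Suc 1 / fact 1"
  proof (rule complex_Taylor[of ?S])
    fix i z assume z: "z \<in> ?S" and i: "i \<le> (1::nat)"
    have "((\<lambda>z. z powr (1 - w) / (1 - w)) has_field_derivative z powr (- w)) (at z within ?S)"
      using nonpos[OF z] assms by (auto intro!: derivative_eq_intros)
    moreover have "((\<lambda>z. z powr (- w)) has_field_derivative - w * z powr (- w - 1)) (at z within ?S)"
      using nonpos[OF z] assms by (auto intro!: derivative_eq_intros)
    moreover have "i = 0 \<or> i = 1"
      using i by linarith
    ultimately show "(f i has_field_derivative f (Suc i) z) (at z within ?S)"
      by (elim disjE) (simp_all add: f_def)
  next
    fix z assume z: "z \<in> ?S"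
    have "cmod (z powr (- w - 1)) = Re z powr (- Re w - 1)"
      using S[OF z] by (subst norm_powr_real_powr) auto
    also have "\<dots> \<le> real (Suc n) powr (- Re w - 1)"
      using S[OF z] assms by (intro powr_mono2') auto
    finally show "cmod (f (Suc 1) z) \<le> cmod w * real (Suc n) powr (- Re w - 1)"
      by (simp add: f_def norm_mult mult_left_mono)
  qed auto
  also have "f 0 (of_nat (Suc (Suc n))) -
      (\<Sum>i\<le>1. f i (of_nat (Suc n)) * (of_nat (Suc (Suc n)) - of_nat (Suc n)) ^ i / fact i)
      = - zeta_term n w"
    by (simp add: f_def zeta_term_def diff_divide_distrib)
  finally show ?thesis
    by simp
qed

definition zeta_cont :: "complex \<Rightarrow> complex" where
  "zeta_cont w = 1 / (w - 1) + (\<Sum>n. zeta_term n w)"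

lemma summable_powr_Suc: "b < -1 \<Longrightarrow> summable (\<lambda>n. real (Suc n) powr b)"
  using summable_real_powr_iff[of b] summable_Suc_iff[of "\<lambda>n. real n powr b"] by simp

lemma summable_zeta_term:
  assumes "Re w > 0" "w \<noteq> 1"
  shows "summable (\<lambda>n. zeta_term n w)"
proof (rule summable_comparison_test')
  show "summable (\<lambda>n. cmod w * real (Suc n) powr (- Re w - 1))"
    using assms by (intro summable_mult summable_powr_Suc) auto
qed (use norm_zeta_term_le[OF assms] in auto)

lemma holomorphic_zeta_cont: "zeta_cont holomorphic_on ({w. 0 < Re w} - {1})"
proof -
  let ?S = "{w. 0 < Re w} - {1 :: complex}"
  have op: "open ?S"
    by (intro open_delete open_halfspace_Re_gt)
  have "(\<lambda>w. \<Sum>n. zeta_term n w) holomorphic_on ?S"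
  proof (rule holomorphic_uniform_sequence[OF op, of "\<lambda>N w. \<Sum>n<N. zeta_term n w"])
    show "(\<lambda>w. \<Sum>n<N. zeta_term n w) holomorphic_on ?S" for N
      unfolding zeta_term_def by (intro holomorphic_intros) auto
  next
    fix z assume "z \<in> ?S"
    with op obtain r where r: "r > 0" "cball z r \<subseteq> ?S"
      using open_contains_cball by blast
    \<comment> \<open>The least real part on the disc, attained at \<open>z - r\<close>; it is
      positive because that point lies in the open half-plane. It makes the bound on the terms
      uniform over the disc.\<close>
    define b where "b = Re z - r"
    have b: "b > 0"
    proof -
      have "z - of_real r \<in> cball z r"
        using r by (simp add: dist_norm)
      hence "z - of_real r \<in> ?S"
        using r by blast
      thus ?thesis
        by (simp add: b_def)
    qed
    have "uniform_limit (cball z r) (\<lambda>N w. \<Sum>n<N. zeta_term n w) (\<lambda>w. \<Sum>n. zeta_term n w) sequentially"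
    proof (rule Weierstrass_m_test)
      show "summable (\<lambda>n. (cmod z + r) * real (Suc n) powr (- b - 1))"
        using b by (intro summable_mult summable_powr_Suc) auto
    next
      fix n w assume w: "w \<in> cball z r"
      have "cmod w \<le> cmod z + r"
        using w norm_triangle_sub[of w z] by (simp add: dist_norm norm_minus_commute)
      moreover have "Re z - Re w \<le> r"
        using w complex_Re_le_cmod[of "z - w"] by (simp add: dist_norm)
      hence "real (Suc n) powr (- Re w - 1) \<le> real (Suc n) powr (- b - 1)"
        by (intro powr_mono) (auto simp: b_def)
      moreover have "w \<in> ?S"
        using w r by blast
      hence "cmod (zeta_term n w) \<le> cmod w * real (Suc n) powr (- Re w - 1)"
        by (intro norm_zeta_term_le) auto
      ultimately show "cmod (zeta_term n w) \<le> (cmod z + r) * real (Suc n) powr (- b - 1)"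
        using r by (elim order_trans) (intro mult_mono, auto)
    qed
    with r show "\<exists>d>0. cball z d \<subseteq> ?S \<and> uniform_limit (cball z d)
        (\<lambda>N w. \<Sum>n<N. zeta_term n w) (\<lambda>w. \<Sum>n. zeta_term n w) sequentially"
      by blast
  qed
  moreover have "(\<lambda>w. 1 / (w - 1)) holomorphic_on ?S"
    by (intro holomorphic_intros) auto
  ultimately have "(\<lambda>w. 1 / (w - 1) + (\<Sum>n. zeta_term n w)) holomorphic_on ?S"
    by (intro holomorphic_on_add)
  thus ?thesis
    unfolding zeta_cont_def .
qed

lemma sum_zeta_term:
  "(\<Sum>n<N. zeta_term n w) =
     (\<Sum>n<N. of_nat (Suc n) powr (- w)) - (of_nat (Suc N) powr (1 - w) - 1) / (1 - w)"
  by (induction N) (auto simp: zeta_term_def diff_divide_distrib)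

text \<open>The integrals in \<open>zeta_term\<close> telescope. For \<open>Re w > 1\<close> the
  upper boundary term tends to 0, and the lower one contributes exactly the pole term
  \<open>1 / (w - 1)\<close>.\<close>

lemma zeta_cont_sums:
  assumes "Re w > 1"
  shows "(\<lambda>n. 1 / of_nat (Suc n) powr w) sums zeta_cont w"
proof -
  have w: "w \<noteq> 1" "Re w > 0"
    using assms by auto
  have "(\<lambda>N. complex_of_real (real (Suc N)) powr (1 - w)) \<longlonglongrightarrow> 0"
  proof (rule tendsto_norm_zero_cancel, subst norm_powr_real_powr)
    show "(\<lambda>N. Re (complex_of_real (real (Suc N))) powr Re (1 - w)) \<longlonglongrightarrow> 0"
      using assms LIMSEQ_Suc[OF tendsto_neg_powr[OF _ filterlim_real_sequentially, of "Re (1 - w)"]]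
      by simp
  qed auto
  hence lim: "(\<lambda>N. of_nat (Suc N) powr (1 - w)) \<longlonglongrightarrow> 0"
    by simp
  have "(\<lambda>N. (\<Sum>n<N. zeta_term n w) + (of_nat (Suc N) powr (1 - w) - 1) / (1 - w))
          \<longlonglongrightarrow> (\<Sum>n. zeta_term n w) + (0 - 1) / (1 - w)"
    using w by (intro tendsto_intros lim summable_LIMSEQ summable_zeta_term) auto
  also have "(\<Sum>n. zeta_term n w) + (0 - 1) / (1 - w) = zeta_cont w"
    using w by (simp add: zeta_cont_def field_simps)
  finally show ?thesis
    unfolding sums_def sum_zeta_term by (simp add: powr_minus field_simps)
qed

lemma zeta_eq_zeta_cont:
  assumes "Re w > 0" "w \<noteq> 1"
  shows "zeta w = zeta_cont w"
  using assms holomorphic_zeta_cont zeta_cont_sums by (intro zeta_eqI[of w 0]) auto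

text \<open>Lets the estimates run over the reals. Taking \<open>Re\<close> loses nothing at the
  arguments that occur: zeta is shown to be real for \<open>t > 1\<close> and for
  \<open>0 < t < 1\<close>.\<close>

definition rzeta :: "real \<Rightarrow> real" where
  "rzeta t = Re (zeta (of_real t))"

text \<open>The terms are real and nonnegative, so the ordinary convergence of the series gives a
  real value and also unconditional summation, which the rearrangements of Dirichlet series
  require.\<close>

lemma zeta_of_real_gt_1:
  assumes "t > 1"
  shows "zeta (of_real t) = of_real (rzeta t)"
    and has_sum_rzeta: "((\<lambda>n. real n powr (- t)) has_sum rzeta t) {0<..}"
proof -
  have "(\<lambda>n. 1 / of_nat (Suc n) powr complex_of_real t) sums zeta (of_real t)"
    using zeta_eq_zeta_cont[of "of_real t"] zeta_cont_sums[of "of_real t"] assms by auto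
  also have "(\<lambda>n. 1 / of_nat (Suc n) powr complex_of_real t) = (\<lambda>n. of_real (real (Suc n) powr (- t)))"
  proof
    fix n
    have "complex_of_real (real (Suc n) powr t) = of_nat (Suc n) powr complex_of_real t"
      by (subst powr_of_real [symmetric]) auto
    thus "1 / of_nat (Suc n) powr complex_of_real t = of_real (real (Suc n) powr (- t))"
      by (simp add: powr_minus divide_inverse)
  qed
  finally have sums: "(\<lambda>n. complex_of_real (real (Suc n) powr (- t))) sums zeta (of_real t)" .
  from sums_Re[OF this] have re: "(\<lambda>n. real (Suc n) powr (- t)) sums rzeta t"
    by (simp add: rzeta_def)
  with sums show "zeta (of_real t) = of_real (rzeta t)"
    using sums_of_real sums_unique2 by blast
  have "((\<lambda>n. real (Suc n) powr (- t)) has_sum rzeta t) UNIV"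
    using re by (intro sums_nonneg_imp_has_sum) auto
  also have "?this \<longleftrightarrow> ((\<lambda>n. real n powr (- t)) has_sum rzeta t) {0<..}"
    by (rule has_sum_reindex_bij_witness[of _ "\<lambda>n. n - 1" Suc]) auto
  finally show "((\<lambda>n. real n powr (- t)) has_sum rzeta t) {0<..}" .
qed

lemma rzeta_pos:
  assumes "t > 1"
  shows "rzeta t > 0"
proof -
  have "(\<Sum>n\<in>{1}. real n powr (- t)) \<le> rzeta t"
    by (rule finite_sum_le_has_sum[OF has_sum_rzeta[OF assms]]) auto
  thus ?thesis
    by simp
qed

section \<open>Partial sums of negative powers\<close>

text \<open>At \<open>w = - a\<close> each \<open>zeta_term\<close> is a real number
  \<open>h n\<close>: a left endpoint value of the decreasing function \<open>t powr a\<close> minus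
  its mean over the unit interval. Hence \<open>h n\<close> lies between 0 and the drop over that
  interval. The approximation error is the tail of the series of \<open>h\<close> from
  \<open>N\<close> on, and the drops telescope to \<open>Suc N powr a\<close>.\<close>

lemma sum_powr_approx:
  fixes a :: real
  assumes "-1 < a" "a < 0"
  shows "zeta (of_real (- a)) = of_real (rzeta (- a))"
    and "\<bar>(\<Sum>n=1..N. real n powr a) - real (Suc N) powr (1 + a) / (1 + a) - rzeta (- a)\<bar>
           \<le> real (Suc N) powr a"
proof -
  define h where "h n = real (Suc n) powr a -
     (real (Suc (Suc n)) powr (1 + a) - real (Suc n) powr (1 + a)) / (1 + a)" for n
  have h: "zeta_term n (of_real (- a)) = of_real (h n)" for n
    unfolding zeta_term_def h_def
    by (simp add: powr_of_real [symmetric])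
  have w: "Re (of_real (- a)) > 0" "complex_of_real (- a) \<noteq> 1"
    using assms by (auto simp: complex_eq_iff)
  have "summable (\<lambda>n. complex_of_real (h n))"
    using summable_zeta_term[OF w] unfolding h .
  hence sum_h: "summable h"
    by (simp only: summable_of_real_iff)
  have z: "zeta (of_real (- a)) = of_real (1 / (- a - 1) + (\<Sum>n. h n))"
    unfolding zeta_eq_zeta_cont[OF w] zeta_cont_def h
    by (simp add: suminf_of_real[OF sum_h])
  thus "zeta (of_real (- a)) = of_real (rzeta (- a))"
    by (simp add: rzeta_def)
  have rz: "rzeta (- a) = (\<Sum>n. h n) - 1 / (1 + a)"
    using z assms by (simp add: rzeta_def field_simps)
  have h_bounds: "0 \<le> h n \<and> h n \<le> real (Suc n) powr a - real (Suc (Suc n)) powr a" for n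
  proof -
    have "\<exists>y. real (Suc n) < y \<and> y < real (Suc (Suc n)) \<and>
        real (Suc (Suc n)) powr (1 + a) / (1 + a) - real (Suc n) powr (1 + a) / (1 + a)
         = (real (Suc (Suc n)) - real (Suc n)) * y powr a"
      using assms by (intro MVT2) (auto intro!: derivative_eq_intros)
    then obtain y where y: "real (Suc n) < y" "y < real (Suc (Suc n))"
        "h n = real (Suc n) powr a - y powr a"
      by (auto simp: h_def diff_divide_distrib)
    moreover have "y powr a \<le> real (Suc n) powr a"
      using y(1) assms by (intro powr_mono2') auto
    moreover have "real (Suc (Suc n)) powr a \<le> y powr a"
      using y(1,2) assms by (intro powr_mono2') auto
    ultimately show ?thesis
      by linarith
  qed
  have sum_eq: "(\<Sum>n<N. h n) = (\<Sum>n=1..N. real n powr a) - (real (Suc N) powr (1 + a) - 1) / (1 + a)"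
    by (induction N) (auto simp: h_def diff_divide_distrib)
  have tail_sums: "(\<lambda>n. h (n + N)) sums ((\<Sum>n. h n) - (\<Sum>n<N. h n))"
    using sum_h by (intro sums_split_initial_segment) (auto simp: summable_sums)
  have "(\<lambda>n. real (n + Suc N) powr a) \<longlonglongrightarrow> 0"
    using assms LIMSEQ_ignore_initial_segment[OF
         tendsto_neg_powr[OF _ filterlim_real_sequentially, of a], of "Suc N"] by simp
  from telescope_sums'[OF this]
  have tele: "(\<lambda>n. real (Suc (n + N)) powr a - real (Suc (Suc (n + N))) powr a) sums (real (Suc N) powr a)"
    by (simp add: add_ac)
  have "(\<Sum>n. h n) - (\<Sum>n<N. h n) \<le> real (Suc N) powr a"
    by (rule sums_le[OF _ tail_sums tele]) (use h_bounds in blast)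
  moreover have "0 \<le> (\<Sum>n. h n) - (\<Sum>n<N. h n)"
    by (rule sums_le[OF _ sums_zero tail_sums]) (use h_bounds in blast)
  ultimately show "\<bar>(\<Sum>n=1..N. real n powr a) - real (Suc N) powr (1 + a) / (1 + a) - rzeta (- a)\<bar>
           \<le> real (Suc N) powr a"
    unfolding sum_eq rz by (simp add: diff_divide_distrib)
qed

text \<open>Moving the main term from \<open>Suc N\<close>, where \<open>N\<close> is the floor of
  \<open>y\<close>, back to \<open>y\<close> costs at most another \<open>y powr a\<close> by the
  mean value theorem; hence the factor 2.\<close>

lemma sum_powr_asymp:
  fixes a y :: real
  assumes "-1 < a" "a < 0" "y \<ge> 1"
  shows "\<bar>(\<Sum>n | 1 \<le> n \<and> real n \<le> y. real n powr a) - y powr (1 + a) / (1 + a) - rzeta (- a)\<bar>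
           \<le> 2 * y powr a"
proof -
  define N where "N = nat \<lfloor>y\<rfloor>"
  have N: "real N \<le> y" "y < real (Suc N)" "N \<ge> 1"
    using assms by (auto simp: N_def le_nat_floor) linarith+
  have set_eq: "{n. 1 \<le> n \<and> real n \<le> y} = {1..N}"
    using N(1) by (auto simp: N_def le_nat_floor)
  have "\<bar>real (Suc N) powr (1 + a) / (1 + a) - y powr (1 + a) / (1 + a)\<bar> \<le> y powr a"
  proof -
    have "\<exists>v. y < v \<and> v < real (Suc N) \<and>
        real (Suc N) powr (1 + a) / (1 + a) - y powr (1 + a) / (1 + a) = (real (Suc N) - y) * v powr a"
      using assms N by (intro MVT2) (auto intro!: derivative_eq_intros)
    then obtain v where v: "y < v"
        "real (Suc N) powr (1 + a) / (1 + a) - y powr (1 + a) / (1 + a) = (real (Suc N) - y) * v powr a"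
      by blast
    have "v powr a \<le> y powr a"
      using v assms by (intro powr_mono2') auto
    moreover have "0 \<le> real (Suc N) - y" "real (Suc N) - y \<le> 1"
      using N by auto
    ultimately have "(real (Suc N) - y) * v powr a \<le> 1 * y powr a"
      by (intro mult_mono) auto
    with \<open>0 \<le> real (Suc N) - y\<close> show ?thesis
      unfolding v(2) by (simp add: abs_mult)
  qed
  moreover have "real (Suc N) powr a \<le> y powr a"
    using assms N by (intro powr_mono2') auto
  ultimately show ?thesis
    using sum_powr_approx(2)[OF assms(1,2), of N] unfolding set_eq by linarith
qed

subsection \<open>Dirichlet convolution and the Moebius function\<close>

text \<open>Every number divides 0, and a sum over an infinite set is 0 by convention. This lets the
  identities for convolutions hold at every argument.\<close>

lemma dirichlet_conv_0 [simp]: "dirichlet_conv f g 0 = 0"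
  by (simp add: dirichlet_conv_def)

text \<open>Both sides run over the ordered factorisations of \<open>n\<close> into three factors; a
  chain \<open>e dvd d dvd n\<close> corresponds to the pair \<open>(e, d div e)\<close>.\<close>

lemma dirichlet_conv_assoc:
  "dirichlet_conv (dirichlet_conv f g) h = dirichlet_conv f (dirichlet_conv g h)"
proof
  fix n
  show "dirichlet_conv (dirichlet_conv f g) h n = dirichlet_conv f (dirichlet_conv g h) n"
  proof (cases "n = 0")
    case False
    have fin: "finite {d. d dvd m}" if "m dvd n" for m
      using False that by (intro finite_divisors_nat) auto
    have "dirichlet_conv (dirichlet_conv f g) h n
        = (\<Sum>(d,e)\<in>(SIGMA d:{d. d dvd n}. {e. e dvd d}). f e * g (d div e) * h (n div d))"
      unfolding dirichlet_conv_def sum_distrib_right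
      by (subst sum.Sigma) (use fin in auto)
    also have "\<dots> = (\<Sum>(d,e)\<in>(SIGMA d:{d. d dvd n}. {e. e dvd n div d}).
                        f d * (g e * h (n div d div e)))"
      by (rule sum.reindex_bij_witness[of _ "\<lambda>(d,e). (d * e, d)" "\<lambda>(d,e). (e, d div e)"])
         (use False in \<open>auto elim!: dvdE simp: mult_ac\<close>)
    also have "\<dots> = dirichlet_conv f (dirichlet_conv g h) n"
      unfolding dirichlet_conv_def sum_distrib_left
      by (subst sum.Sigma) (use fin in \<open>auto simp: div_dvd_iff_mult\<close>)
    finally show ?thesis .
  qed auto
qed

text \<open>The twist passes through the convolution because \<open>n powr w\<close> is completely
  multiplicative.\<close>

lemma dirichlet_conv_powr:
  "dirichlet_conv (\<lambda>n. f n * real n powr w) (\<lambda>n. g n * real n powr w) n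
     = dirichlet_conv f g n * real n powr w"
proof (cases "n = 0")
  case False
  thus ?thesis
    unfolding dirichlet_conv_def sum_distrib_right
    by (intro sum.cong refl) (auto elim!: dvdE simp: powr_mult)
qed auto

text \<open>Real unconditional summability is absolute, so the product family is absolutely summable
  and its sum can be evaluated iteratively.\<close>

lemma has_sum_mult_times:
  fixes f :: "'a \<Rightarrow> real" and g :: "'b \<Rightarrow> real"
  assumes "(f has_sum F) A" "(g has_sum G) B"
  shows "((\<lambda>(x, y). f x * g y) has_sum F * G) (A \<times> B)"
proof (rule has_sum_SigmaI)
  have f: "(\<lambda>x. \<bar>f x\<bar>) summable_on A" and g: "(\<lambda>x. \<bar>g x\<bar>) summable_on B"
    using assms summable_on_iff_abs_summable_on_real has_sum_imp_summable by fastforce+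
  have "(\<lambda>(x, y). \<bar>f x\<bar> * \<bar>g y\<bar>) summable_on (A \<times> B)"
  proof (rule summable_on_SigmaI)
    show "((\<lambda>y. case (x, y) of (x, y) \<Rightarrow> \<bar>f x\<bar> * \<bar>g y\<bar>) has_sum \<bar>f x\<bar> * infsum (\<lambda>y. \<bar>g y\<bar>) B) B" for x
      using g by (auto intro!: has_sum_cmult_right)
    show "(\<lambda>x. \<bar>f x\<bar> * infsum (\<lambda>y. \<bar>g y\<bar>) B) summable_on A"
      using f by (rule summable_on_cmult_left)
  qed auto
  hence "(\<lambda>z. norm (case z of (x, y) \<Rightarrow> f x * g y)) summable_on (A \<times> B)"
    by (simp add: case_prod_unfold abs_mult)
  thus "(\<lambda>(x, y). f x * g y) summable_on (A \<times> B)"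
    by (rule abs_summable_summable)
  show "((\<lambda>y. case (x, y) of (x, y) \<Rightarrow> f x * g y) has_sum f x * G) B" for x
    using assms(2) by (auto intro!: has_sum_cmult_right)
  show "((\<lambda>x. f x * G) has_sum F * G) A"
    using assms(1) by (rule has_sum_cmult_left)
qed

text \<open>The product of the two series is regrouped by the product of the two indices; each group
  is a finite sum over divisors.\<close>

lemma has_sum_dirichlet_conv:
  assumes "(f has_sum F) {0<..}" "(g has_sum G) {0<..}"
  shows "(dirichlet_conv f g has_sum F * G) {0<..}"
proof (rule has_sum_SigmaD)
  have "((\<lambda>(n, d). f d * g (n div d)) has_sum F * G) (SIGMA n:{0<..}. {d. d dvd n}) \<longleftrightarrow>
        ((\<lambda>(x, y). f x * g y) has_sum F * G) ({0<..} \<times> {0<..})"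
    by (rule has_sum_reindex_bij_witness[of _ "\<lambda>(d,e). (d * e, d)" "\<lambda>(n,d). (d, n div d)"])
       (auto elim!: dvdE)
  thus "((\<lambda>(n, d). f d * g (n div d)) has_sum F * G) (SIGMA n:{0<..}. {d. d dvd n})"
    using has_sum_mult_times[OF assms] by blast
  show "((\<lambda>d. case (n, d) of (n, d) \<Rightarrow> f d * g (n div d)) has_sum dirichlet_conv f g n) {d. d dvd n}"
    if "n \<in> {0<..}" for n
    using that by (intro has_sum_finiteI) (auto simp: dirichlet_conv_def)
qed

lemma has_sum_dirichlet_conv_powr:
  assumes "((\<lambda>n. f n * real n powr w) has_sum F) {0<..}" "((\<lambda>n. g n * real n powr w) has_sum G) {0<..}"
  shows "((\<lambda>n. dirichlet_conv f g n * real n powr w) has_sum F * G) {0<..}"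
  using has_sum_dirichlet_conv[OF assms] unfolding dirichlet_conv_powr .

text \<open>Substitution \<open>k = u * v\<close>. The variable of \<open>f\<close> is summed
  innermost, so that an asymptotic formula for its partial sums can be inserted at
  \<open>x / v\<close>.\<close>

lemma sum_dirichlet_conv:
  "(\<Sum>k | 1 \<le> k \<and> real k \<le> x. dirichlet_conv f g k)
     = (\<Sum>v | 1 \<le> v \<and> real v \<le> x. g v * (\<Sum>u | 1 \<le> u \<and> real u \<le> x / real v. f u))"
proof -
  have fin: "finite {k. 1 \<le> k \<and> real k \<le> y}" for y
    by (rule finite_subset[of _ "{..nat \<lfloor>y\<rfloor>}"]) (auto simp: le_nat_floor)
  have "(\<Sum>k | 1 \<le> k \<and> real k \<le> x. dirichlet_conv f g k)
      = (\<Sum>(k,d)\<in>(SIGMA k:{k. 1 \<le> k \<and> real k \<le> x}. {d. d dvd k}). f d * g (k div d))"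
    unfolding dirichlet_conv_def by (subst sum.Sigma) (use fin in auto)
  also have "\<dots> = (\<Sum>(v,u)\<in>(SIGMA v:{v. 1 \<le> v \<and> real v \<le> x}. {u. 1 \<le> u \<and> real u \<le> x / real v}). g v * f u)"
  proof (rule sum.reindex_bij_witness[of _ "\<lambda>(v,u). (u * v, u)" "\<lambda>(k,d). (k div d, d)"], goal_cases)
    case (2 a)
    then obtain d e where a: "a = (d * e, d)" "d > 0" "e > 0" "real (d * e) \<le> x"
      by (auto elim!: dvdE)
    have "real e \<le> real (d * e)"
      using a by (simp only: of_nat_le_iff) simp
    also note a(4)
    finally show ?case
      using a by (auto simp: field_simps)
  qed (auto elim!: dvdE simp: field_simps)
  also have "\<dots> = (\<Sum>v | 1 \<le> v \<and> real v \<le> x. g v * (\<Sum>u | 1 \<le> u \<and> real u \<le> x / real v. f u))"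
    unfolding sum_distrib_left by (subst sum.Sigma) (use fin in auto)
  finally show ?thesis .
qed

section \<open>The Moebius function and its Dirichlet series\<close>

lemma moebius_mu_1 [simp]: "moebius_mu (Suc 0) = 1"
  by (simp add: moebius_mu_def)

lemma abs_moebius_mu: "\<bar>moebius_mu n\<bar> = (if squarefree n then 1 else 0)"
  by (simp add: moebius_mu_def)

lemma squarefree_prime_mult_iff:
  fixes p d :: nat
  assumes "prime p"
  shows "squarefree (p * d) \<longleftrightarrow> squarefree d \<and> \<not> p dvd d"
proof safe
  assume "squarefree (p * d)" "p dvd d"
  hence "p dvd 1"
    by (intro squarefreeD[of "p * d"]) (simp_all add: power2_eq_square)
  with assms show False
    by simp
next
  assume "squarefree d" "\<not> p dvd d"
  thus "squarefree (p * d)"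
    using assms squarefree_prime[OF assms]
    by (intro squarefree_mult_coprime) (auto simp: prime_imp_coprime)
qed (auto dest: squarefree_multD)

lemma moebius_mu_prime_mult:
  assumes "prime p" "\<not> p dvd d"
  shows "moebius_mu (p * d) = - moebius_mu d"
proof -
  have d: "d \<noteq> 0"
    using assms(2) by (metis dvd_0_right)
  have "prime_factors (p * d) = insert p (prime_factors d)"
    using assms d by (subst prime_factorization_mult) (auto simp: prime_factorization_prime)
  moreover have "p \<notin> prime_factors d"
    using assms by (auto simp: prime_factors_dvd)
  ultimately show ?thesis
    using assms by (simp add: moebius_mu_def squarefree_prime_mult_iff)
qed

text \<open>For a prime \<open>p\<close> dividing \<open>n\<close>, the map from \<open>d\<close> to
  \<open>p * d\<close> pairs the squarefree divisors prime to \<open>p\<close> with those divisible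
  by \<open>p\<close>, and the two members of a pair have opposite signs.\<close>

lemma sum_moebius_mu_divisors:
  assumes "n > 0"
  shows "(\<Sum>d | d dvd n. moebius_mu d) = (if n = 1 then 1 else 0)"
proof (cases "n = 1")
  case True
  thus ?thesis
    by (simp add: moebius_mu_def)
next
  case False
  then obtain p where p: "prime p" "p dvd n"
    using prime_factor_nat by blast
  have fin: "finite {d. d dvd n}"
    using assms by simp
  define A where "A = {d. d dvd n \<and> squarefree d \<and> \<not> p dvd d}"
  define B where "B = {d. d dvd n \<and> squarefree d \<and> p dvd d}"
  have "(\<Sum>d\<in>B. moebius_mu d) = (\<Sum>d\<in>A. - moebius_mu d)"
  proof (rule sum.reindex_bij_witness[of _ "\<lambda>d. p * d" "\<lambda>d. d div p"], goal_cases)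
    case (2 d)
    then obtain e where e: "d = p * e" "squarefree (p * e)" "p * e dvd n"
      by (auto simp: B_def)
    with p show ?case
      by (auto simp: A_def squarefree_prime_mult_iff dest: dvd_mult_right)
  next
    case (4 d)
    hence d: "d dvd n" "squarefree d" "\<not> p dvd d"
      by (auto simp: A_def)
    have co: "coprime p d"
      using d p by (simp add: prime_imp_coprime)
    with d p show ?case
      by (auto simp: B_def squarefree_prime_mult_iff intro!: divides_mult)
  next
    case (5 d)
    then obtain e where e: "d = p * e" "squarefree (p * e)"
      by (auto simp: B_def)
    with p show ?case
      by (simp add: moebius_mu_prime_mult squarefree_prime_mult_iff)
  qed (use p in \<open>auto simp: A_def B_def\<close>)
  moreover have "(\<Sum>d | d dvd n. moebius_mu d) = (\<Sum>d\<in>A \<union> B. moebius_mu d)"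
    using fin by (intro sum.mono_neutral_right) (auto simp: A_def B_def moebius_mu_def)
  moreover have "\<dots> = (\<Sum>d\<in>A. moebius_mu d) + (\<Sum>d\<in>B. moebius_mu d)"
    by (intro sum.union_disjoint) (auto simp: A_def B_def intro: finite_subset[OF _ fin])
  ultimately show ?thesis
    using False by (simp add: sum_negf)
qed

text \<open>A prime has exponent in \<open>r\<close> at most 1, so halving its exponent in the
  product and rounding down recovers its exponent in \<open>q\<close>. This is the uniqueness of the
  decomposition into a square and a squarefree factor.\<close>

lemma square_part_mult_squarefree:
  fixes q r :: nat
  assumes "squarefree r" "q > 0"
  shows "square_part (q\<^sup>2 * r) = q" "squarefree_part (q\<^sup>2 * r) = r"
proof -
  have r: "r > 0"
    using assms(1) by (metis not_squarefree_0 gr0I)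
  have mult_eq: "multiplicity p (square_part (q\<^sup>2 * r)) = multiplicity p q" if "prime p" for p
  proof -
    have "multiplicity p r \<le> 1"
      using assms(1) that r by (subst (asm) squarefree_factorial_semiring'') auto
    thus ?thesis
      using that r assms(2)
      by (simp add: prime_multiplicity_square_part prime_elem_multiplicity_mult_distrib
            prime_elem_multiplicity_power_distrib)
  qed
  have "square_part (q\<^sup>2 * r) > 0"
    unfolding neq0_conv [symmetric] square_part_0_iff using assms(2) r by simp
  thus *: "square_part (q\<^sup>2 * r) = q"
    by (rule multiplicity_eq_nat[OF _ assms(2) mult_eq])
  have "q\<^sup>2 * squarefree_part (q\<^sup>2 * r) = q\<^sup>2 * r"
    using squarefree_decompose[of "q\<^sup>2 * r"] unfolding * by (metis mult.commute)
  thus "squarefree_part (q\<^sup>2 * r) = r"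
    using assms(2) by simp
qed

text \<open>Comparison with the zeta series gives some sum \<open>X\<close>. Convolving with the
  constant 1 leaves only the term at 1, hence \<open>X * rzeta t = 1\<close>.\<close>

lemma has_sum_moebius_mu:
  assumes "t > 1"
  shows "((\<lambda>n. moebius_mu n * real n powr (- t)) has_sum 1 / rzeta t) {0<..}"
proof -
  have "(\<lambda>n. norm (moebius_mu n * real n powr (- t))) summable_on {0<..}"
    by (rule Infinite_Sum.abs_summable_on_comparison_test'[OF has_sum_imp_summable[OF has_sum_rzeta[OF assms]]])
       (auto simp: abs_mult abs_moebius_mu)
  then obtain X where X: "((\<lambda>n. moebius_mu n * real n powr (- t)) has_sum X) {0<..}"
    using abs_summable_summable summable_on_def by blast
  have "((\<lambda>n. dirichlet_conv moebius_mu (\<lambda>_. 1) n * real n powr (- t)) has_sum X * rzeta t) {0<..}"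
    using has_sum_rzeta[OF assms] by (intro has_sum_dirichlet_conv_powr X) simp
  also have "?this \<longleftrightarrow> ((\<lambda>n. 1) has_sum X * rzeta t) {1::nat}"
    by (intro has_sum_cong_neutral) (auto simp: dirichlet_conv_def sum_moebius_mu_divisors)
  finally have "X * rzeta t = 1"
    by (simp add: has_sum_finite_iff)
  hence "X = 1 / rzeta t"
    using rzeta_pos[OF assms] by (simp add: field_simps)
  with X show ?thesis
    by simp
qed

text \<open>The function is the indicator of squarefree numbers. Writing each positive
  \<open>n\<close> uniquely as \<open>q\<^sup>2 * r\<close> with \<open>r\<close> squarefree factors
  \<open>rzeta t\<close> as \<open>rzeta (2 * t)\<close> times the wanted sum.\<close>

lemma has_sum_abs_moebius_mu:
  assumes "t > 1"
  shows "((\<lambda>n. \<bar>moebius_mu n\<bar> * real n powr (- t)) has_sum rzeta t / rzeta (2 * t)) {0<..}"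
proof -
  have "(\<lambda>n. norm (\<bar>moebius_mu n\<bar> * real n powr (- t))) summable_on {0<..}"
    by (rule Infinite_Sum.abs_summable_on_comparison_test'[OF has_sum_imp_summable[OF has_sum_rzeta[OF assms]]])
       (auto simp: abs_mult abs_moebius_mu)
  then obtain Y where Y: "((\<lambda>n. \<bar>moebius_mu n\<bar> * real n powr (- t)) has_sum Y) {0<..}"
    using abs_summable_summable summable_on_def by blast
  also have "?this \<longleftrightarrow> ((\<lambda>n. real n powr (- t)) has_sum Y) {n. squarefree n}"
    by (intro has_sum_cong_neutral) (auto simp: abs_moebius_mu intro!: Nat.gr0I)
  finally have Y': "((\<lambda>n. real n powr (- t)) has_sum Y) {n. squarefree n}" .
  have "((\<lambda>(q, r). real q powr (- (2 * t)) * real r powr (- t)) has_sum rzeta (2 * t) * Y)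
          ({0<..} \<times> {n. squarefree n})"
    using assms by (intro has_sum_mult_times has_sum_rzeta Y') auto
  also have "?this \<longleftrightarrow> ((\<lambda>n. real n powr (- t)) has_sum rzeta (2 * t) * Y) {0<..}"
  proof (rule has_sum_reindex_bij_witness[of _ "\<lambda>n. (square_part n, squarefree_part n)" "\<lambda>(q, r). q\<^sup>2 * r"],
         goal_cases)
    case (2 z)
    thus ?case
      by (auto intro!: Nat.gr0I)
  next
    case (3 n)
    show ?case
      using squarefree_decompose[of n] by (simp add: mult.commute)
  next
    case (4 n)
    thus ?case
      by (simp add: neq0_conv [symmetric] del: neq0_conv)
  next
    case (5 z)
    thus ?case
      by (auto simp: powr_mult powr_powr simp flip: powr_numeral)
  qed (auto simp: square_part_mult_squarefree)
  finally have "rzeta t = rzeta (2 * t) * Y"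
    using has_sum_rzeta[OF assms] has_sum_unique by blast
  moreover have "rzeta (2 * t) > 0"
    using assms by (intro rzeta_pos) auto
  ultimately have "Y = rzeta t / rzeta (2 * t)"
    by (simp add: field_simps)
  with Y show ?thesis
    by simp
qed

subsection \<open>Asymptotics\<close>

text \<open>The error is the tail beyond \<open>x\<close>, which is dominated termwise by
  \<open>c * w\<close>; the tail of \<open>w\<close> is at most its full sum
  \<open>T\<close>.\<close>

lemma sum_approx_has_sum:
  fixes h w :: "nat \<Rightarrow> real"
  assumes "(h has_sum G) {0<..}" "(w has_sum T) {0<..}" "c \<ge> 0" "\<And>v. w v \<ge> 0"
    and "\<And>v. real v > x \<Longrightarrow> \<bar>h v\<bar> \<le> c * w v"
  shows "\<bar>(\<Sum>v | 1 \<le> v \<and> real v \<le> x. h v) - G\<bar> \<le> c * T"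
proof -
  let ?V = "{v. 1 \<le> v \<and> real v \<le> x}"
  have fin: "finite ?V"
    by (rule finite_subset[of _ "{..nat \<lfloor>x\<rfloor>}"]) (auto simp: le_nat_floor)
  have h: "(h has_sum (G - sum h ?V)) ({0<..} - ?V)"
    using assms(1) fin by (intro has_sum_Diff has_sum_finite) auto
  have w: "(w has_sum (T - sum w ?V)) ({0<..} - ?V)"
    using assms(2) fin by (intro has_sum_Diff has_sum_finite) auto
  have "norm (G - sum h ?V) \<le> c * (T - sum w ?V)"
    by (rule norm_infsum_le[OF h has_sum_cmult_right[OF w]]) (use assms(5) in auto)
  also have "\<dots> \<le> c * T"
    using assms(3,4) by (intro mult_left_mono) (auto intro: sum_nonneg)
  finally show ?thesis
    by (simp add: abs_minus_commute)
qed

text \<open>The one weighted sum \<open>T\<close> controls all three errors: the remainders of the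
  inner sums for \<open>v\<close> up to \<open>x\<close>, and the two tails that complete the
  truncated series to \<open>G1\<close> and \<open>G0\<close>. In the tails \<open>v > x\<close>, so
  \<open>v powr (- (1 + a))\<close> is at most \<open>v powr (- a) / x\<close>, and 1 is at most
  \<open>x powr a * v powr (- a)\<close>.\<close>

lemma sum_dirichlet_conv_id_pow_asymp:
  fixes a :: real and g :: "nat \<Rightarrow> real"
  assumes a: "-1 < a" "a < 0"
    and G1: "((\<lambda>n. g n * real n powr (- (1 + a))) has_sum G1) {0<..}"
    and G0: "(g has_sum G0) {0<..}"
    and T: "((\<lambda>n. \<bar>g n\<bar> * real n powr (- a)) has_sum T) {0<..}"
  shows "\<exists>C. \<forall>x>1. \<bar>(\<Sum>k | 1 \<le> k \<and> real k \<le> x. dirichlet_conv (id_pow a) g k)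
            - (x powr (1 + a) / (1 + a) * G1 + rzeta (- a) * G0)\<bar> \<le> C * x powr a"
proof (intro exI allI impI)
  fix x :: real assume x: "x > 1"
  let ?V = "{v. 1 \<le> v \<and> real v \<le> x}"
  define Z where "Z = rzeta (- a)"
  define P where "P = x powr (1 + a) / (1 + a)"
  define U where "U y = (\<Sum>u | 1 \<le> u \<and> real u \<le> y. id_pow a u)" for y
  define R where "R y = U y - y powr (1 + a) / (1 + a) - Z" for y
  have fin: "finite ?V"
    by (rule finite_subset[of _ "{..nat \<lfloor>x\<rfloor>}"]) (auto simp: le_nat_floor)
  have R: "\<bar>R y\<bar> \<le> 2 * y powr a" if "y \<ge> 1" for y
    using sum_powr_asymp[OF a that] by (simp add: R_def U_def Z_def id_pow_def)
  have "(\<Sum>k | 1 \<le> k \<and> real k \<le> x. dirichlet_conv (id_pow a) g k) = (\<Sum>v\<in>?V. g v * U (x / real v))"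
    unfolding sum_dirichlet_conv U_def ..
  also have "\<dots> = (\<Sum>v\<in>?V. g v * R (x / real v) + P * (g v * real v powr (- (1 + a))) + Z * g v)"
  proof (intro sum.cong refl)
    fix v assume v: "v \<in> ?V"
    have "(x / real v) powr (1 + a) = x powr (1 + a) * real v powr (- (1 + a))"
      unfolding powr_minus_divide using v x by (simp add: powr_divide)
    thus "g v * U (x / real v) = g v * R (x / real v) + P * (g v * real v powr (- (1 + a))) + Z * g v"
      by (simp add: R_def P_def algebra_simps)
  qed
  also have "\<dots> = (\<Sum>v\<in>?V. g v * R (x / real v)) + P * (\<Sum>v\<in>?V. g v * real v powr (- (1 + a)))
                    + Z * (\<Sum>v\<in>?V. g v)"
    by (simp only: sum.distrib sum_distrib_left)
  finally have split: "(\<Sum>k | 1 \<le> k \<and> real k \<le> x. dirichlet_conv (id_pow a) g k) - (P * G1 + Z * G0)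
      = (\<Sum>v\<in>?V. g v * R (x / real v)) + P * ((\<Sum>v\<in>?V. g v * real v powr (- (1 + a))) - G1)
                    + Z * ((\<Sum>v\<in>?V. g v) - G0)"
    by (simp add: algebra_simps)
  have "\<bar>\<Sum>v\<in>?V. g v * R (x / real v)\<bar> \<le> (\<Sum>v\<in>?V. 2 * x powr a * (\<bar>g v\<bar> * real v powr (- a)))"
  proof (rule order_trans[OF sum_abs sum_mono])
    fix v assume v: "v \<in> ?V"
    have "\<bar>g v * R (x / real v)\<bar> \<le> \<bar>g v\<bar> * (2 * (x / real v) powr a)"
      unfolding abs_mult using v by (intro mult_left_mono R) auto
    also have "(x / real v) powr a = x powr a * real v powr (- a)"
      using v x by (simp add: powr_divide powr_minus_divide)
    finally show "\<bar>g v * R (x / real v)\<bar> \<le> 2 * x powr a * (\<bar>g v\<bar> * real v powr (- a))"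
      by (simp add: mult_ac)
  qed
  also have "\<dots> \<le> 2 * x powr a * T"
    unfolding sum_distrib_left [symmetric] using fin
    by (intro mult_left_mono finite_sum_le_has_sum[OF T]) auto
  finally have 1: "\<bar>\<Sum>v\<in>?V. g v * R (x / real v)\<bar> \<le> 2 * T * x powr a"
    by (simp add: mult_ac)
  have "\<bar>(\<Sum>v\<in>?V. g v * real v powr (- (1 + a))) - G1\<bar> \<le> x powr (- 1) * T"
  proof (rule sum_approx_has_sum[OF G1 T])
    fix v assume v: "real v > x"
    have "real v powr (- (1 + a)) = real v powr (- 1) * real v powr (- a)"
      unfolding powr_add [symmetric] by simp
    also have "\<dots> \<le> x powr (- 1) * real v powr (- a)"
      using v x by (intro mult_right_mono powr_mono2') auto
    finally have "\<bar>g v\<bar> * real v powr (- (1 + a)) \<le> \<bar>g v\<bar> * (x powr (- 1) * real v powr (- a))"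
      by (rule mult_left_mono) simp
    thus "\<bar>g v * real v powr (- (1 + a))\<bar> \<le> x powr (- 1) * (\<bar>g v\<bar> * real v powr (- a))"
      by (simp only: abs_mult abs_of_nonneg powr_ge_zero mult.left_commute)
  qed auto
  moreover have P: "P \<ge> 0"
    using a by (simp add: P_def)
  ultimately have "\<bar>P * ((\<Sum>v\<in>?V. g v * real v powr (- (1 + a))) - G1)\<bar> \<le> P * (x powr (- 1) * T)"
    unfolding abs_mult abs_of_nonneg[OF P] by (rule mult_left_mono)
  also have "P * (x powr (- 1) * T) = T / (1 + a) * (x powr (1 + a) * x powr (- 1))"
    by (simp add: P_def)
  also have "x powr (1 + a) * x powr (- 1) = x powr a"
    unfolding powr_add [symmetric] by simp
  finally have 2: "\<bar>P * ((\<Sum>v\<in>?V. g v * real v powr (- (1 + a))) - G1)\<bar> \<le> T / (1 + a) * x powr a" .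
  have "\<bar>(\<Sum>v\<in>?V. g v) - G0\<bar> \<le> x powr a * T"
  proof (rule sum_approx_has_sum[OF G0 T])
    fix v assume v: "real v > x"
    have "1 = real v powr a * real v powr (- a)"
      using v x by (simp flip: powr_add)
    also have "\<dots> \<le> x powr a * real v powr (- a)"
      using v x a by (intro mult_right_mono powr_mono2') auto
    finally show "\<bar>g v\<bar> \<le> x powr a * (\<bar>g v\<bar> * real v powr (- a))"
      using mult_left_mono[of 1 "x powr a * real v powr (- a)" "\<bar>g v\<bar>"]
      by (simp only: mult_ac abs_ge_zero mult_1_left)
  qed auto
  hence "\<bar>Z * ((\<Sum>v\<in>?V. g v) - G0)\<bar> \<le> \<bar>Z\<bar> * (x powr a * T)"
    unfolding abs_mult by (rule mult_left_mono) simp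
  hence 3: "\<bar>Z * ((\<Sum>v\<in>?V. g v) - G0)\<bar> \<le> \<bar>Z\<bar> * T * x powr a"
    by (simp only: mult_ac)
  \<comment> \<open>The three bounds add up to a constant built from \<open>T\<close>,
    \<open>a\<close> and \<open>Z\<close> alone, hence independent of \<open>x\<close>.\<close>
  have "\<bar>(\<Sum>k | 1 \<le> k \<and> real k \<le> x. dirichlet_conv (id_pow a) g k) - (P * G1 + Z * G0)\<bar>
      \<le> (2 * T + T / (1 + a) + \<bar>Z\<bar> * T) * x powr a"
    unfolding split distrib_right using 1 2 3 by linarith
  thus "\<bar>(\<Sum>k | 1 \<le> k \<and> real k \<le> x. dirichlet_conv (id_pow a) g k)
            - (x powr (1 + a) / (1 + a) * G1 + rzeta (- a) * G0)\<bar>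
        \<le> (2 * T + T / (1 + a) + \<bar>rzeta (- a)\<bar> * T) * x powr a"
    by (simp add: P_def Z_def)
qed

text \<open>Keeping \<open>M\<close> and its Dirichlet series \<open>D\<close> abstract treats
  \<open>phi\<close> and \<open>psi\<close> together, and keeping \<open>m\<close> arbitrary covers
  both the index 1 and the even indices.\<close>

lemma H_asymp:
  fixes s m :: nat and a :: real
  assumes s: "s \<ge> 2" and m: "m \<ge> 1" and a: "-1 < a" "a < 0"
    and D: "\<And>t. t > 1 \<Longrightarrow> ((\<lambda>n. M n * real n powr (- t)) has_sum D t) {0<..}"
  shows "\<exists>C. \<forall>x>1. \<bar>H s m x (dirichlet_conv (id_pow (real s + a)) M) - bernoulli m *
     (x powr (1 + a) / (1 + a) * (D (real s + a + 1) * (1 / rzeta (real s + a + 1) * rzeta (real (m * s) + a + 1)))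
      + rzeta (- a) * (D (real s) * (1 / rzeta (real s) * rzeta (real (m * s)))))\<bar> \<le> C * x powr a"
proof -
  define Ms where "Ms n = M n * real n powr (- real s)" for n
  define mus where "mus n = moebius_mu n * real n powr (- real s)" for n
  define g where "g = dirichlet_conv Ms (dirichlet_conv mus (id_pow (- real (m * s))))"
  have ms: "real (m * s) \<ge> real s"
    using m by (simp only: of_nat_le_iff) simp
  \<comment> \<open>Used at \<open>t = 1 + a\<close> and \<open>t = 0\<close> for the two main
    terms, and at \<open>t = a\<close> for the error, where \<open>s \<ge> 2\<close> and
    \<open>a > -1\<close> give \<open>s + a > 1\<close>.\<close>
  have g: "((\<lambda>n. g n * real n powr (- t)) has_sum
      (D (real s + t) * (1 / rzeta (real s + t) * rzeta (real (m * s) + t)))) {0<..}" if "real s + t > 1" for t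
    unfolding g_def
  proof (intro has_sum_dirichlet_conv_powr)
    show "((\<lambda>n. Ms n * real n powr (- t)) has_sum D (real s + t)) {0<..}"
      using D[of "real s + t"] that by (simp add: Ms_def mult.assoc flip: powr_add)
    show "((\<lambda>n. mus n * real n powr (- t)) has_sum 1 / rzeta (real s + t)) {0<..}"
      using has_sum_moebius_mu[of "real s + t"] that by (simp add: mus_def mult.assoc flip: powr_add)
    show "((\<lambda>n. id_pow (- real (m * s)) n * real n powr (- t)) has_sum rzeta (real (m * s) + t)) {0<..}"
      using has_sum_rzeta[of "real (m * s) + t"] that ms by (simp add: id_pow_def flip: powr_add)
  qed
  have H: "H s m x (dirichlet_conv (id_pow (real s + a)) M) =
      bernoulli m * (\<Sum>k | 1 \<le> k \<and> real k \<le> x. dirichlet_conv (id_pow a) g k)" for x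
  proof -
    have "(\<lambda>n. id_pow (real s + a) n * real n powr (- real s)) = id_pow a"
      by (auto simp: id_pow_def simp flip: powr_add)
    thus ?thesis
      by (simp add: H_eq_sum_dirichlet_conv g_def Ms_def [abs_def] mus_def [abs_def] dirichlet_conv_assoc
               flip: dirichlet_conv_powr)
  qed
  have "((\<lambda>n. g n * real n powr (- (1 + a))) has_sum
      (D (real s + a + 1) * (1 / rzeta (real s + a + 1) * rzeta (real (m * s) + a + 1)))) {0<..}"
    using g[of "1 + a"] s a by (simp add: add_ac)
  moreover have "(g has_sum (D (real s) * (1 / rzeta (real s) * rzeta (real (m * s))))) {0<..}"
  proof -
    have "real s + 0 > 1"
      using s by simp
    \<comment> \<open>The extra factor is 1 only for positive \<open>n\<close>, since
      \<open>0 powr 0\<close> is 0; the index set excludes that point.\<close>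
    moreover have "(g has_sum V) {0<..} \<longleftrightarrow> ((\<lambda>n. g n * real n powr (- 0)) has_sum V) {0<..}" for V
      by (intro has_sum_cong) auto
    ultimately show ?thesis
      using g[of 0] unfolding add_0_right by blast
  qed
  moreover have "((\<lambda>n. \<bar>g n\<bar> * real n powr (- a)) has_sum infsum (\<lambda>n. \<bar>g n\<bar> * real n powr (- a)) {0<..}) {0<..}"
  proof (rule has_sum_infsum)
    have "(\<lambda>n. g n * real n powr (- a)) summable_on {0<..}"
      using g[of a] s a by (intro has_sum_imp_summable) auto
    hence "(\<lambda>n. norm (g n * real n powr (- a))) summable_on {0<..}"
      by (subst (asm) summable_on_iff_abs_summable_on_real)
    thus "(\<lambda>n. \<bar>g n\<bar> * real n powr (- a)) summable_on {0<..}"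
      by (simp add: abs_mult)
  qed
  ultimately obtain C where C: "\<forall>x>1. \<bar>(\<Sum>k | 1 \<le> k \<and> real k \<le> x. dirichlet_conv (id_pow a) g k)
     - (x powr (1 + a) / (1 + a) * (D (real s + a + 1) * (1 / rzeta (real s + a + 1) * rzeta (real (m * s) + a + 1)))
      + rzeta (- a) * (D (real s) * (1 / rzeta (real s) * rzeta (real (m * s)))))\<bar> \<le> C * x powr a"
    using sum_dirichlet_conv_id_pow_asymp[OF a] by blast
  show ?thesis
  proof (intro exI allI impI)
    fix x :: real assume "x > 1"
    with C have "\<bar>bernoulli m\<bar> * \<bar>(\<Sum>k | 1 \<le> k \<and> real k \<le> x. dirichlet_conv (id_pow a) g k)
     - (x powr (1 + a) / (1 + a) * (D (real s + a + 1) * (1 / rzeta (real s + a + 1) * rzeta (real (m * s) + a + 1)))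
      + rzeta (- a) * (D (real s) * (1 / rzeta (real s) * rzeta (real (m * s)))))\<bar>
      \<le> \<bar>bernoulli m\<bar> * (C * x powr a)"
      by (intro mult_left_mono) auto
    thus "\<bar>H s m x (dirichlet_conv (id_pow (real s + a)) M) - bernoulli m *
     (x powr (1 + a) / (1 + a) * (D (real s + a + 1) * (1 / rzeta (real s + a + 1) * rzeta (real (m * s) + a + 1)))
      + rzeta (- a) * (D (real s) * (1 / rzeta (real s) * rzeta (real (m * s)))))\<bar>
      \<le> (\<bar>bernoulli m\<bar> * C) * x powr a"
      unfolding H right_diff_distrib [symmetric] abs_mult by (simp only: mult.assoc)
  qed
qed

text \<open>Carries the real estimates over to the complex-valued zeta: once the main term is known
  to be real, the modulus is an absolute value.\<close>

lemma cmod_approx_of_realI: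
  assumes "\<exists>C. \<forall>x>1. \<bar>h x - e x\<bar> \<le> C * x powr a"
    and "\<And>x. x > 1 \<Longrightarrow> z x = complex_of_real (e x)"
  shows "\<exists>C. \<forall>x>1. cmod (of_real (h x) - z x) \<le> C * x powr a"
proof -
  have "cmod (of_real (h x) - z x) = \<bar>h x - e x\<bar>" if "x > 1" for x
    unfolding assms(2)[OF that] by (simp flip: of_real_diff)
  with assms(1) show ?thesis
    by auto
qed

theorem theorem4:
  fixes s m :: nat and a :: real
  assumes "s \<ge> 2" and "m \<ge> 1" and "-1 < a" and "a < 0"
  shows
    "(\<exists>C. \<forall>x>1. cmod (of_real (H s 1 x (phi (real s + a)))
       - (- (1 / (2 * (1 + of_real a) * zeta (of_real (real s + a + 1)))) * of_real (x powr (1 + a))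
          - zeta (of_real (- a)) / (2 * zeta (of_nat s)))) \<le> C * x powr a)
     \<and>
    (\<exists>C. \<forall>x>1. cmod (of_real (H s 1 x (psi (real s + a)))
       - (- (zeta (of_real (real s + a + 1))
             / (2 * (1 + of_real a) * zeta (of_real (2 * real s + 2 * a + 2)))) * of_real (x powr (1 + a))
          - zeta (of_real (- a)) * zeta (of_nat s) / (2 * zeta (of_nat (2 * s))))) \<le> C * x powr a)
     \<and>
    (\<exists>C. \<forall>x>1. cmod (of_real (H s (2 * m) x (phi (real s + a)))
       - (of_real (bernoulli (2 * m)) * zeta (of_real (2 * real m * real s + a + 1))
             / ((1 + of_real a) * zeta (of_real (real s + a + 1)) ^ 2) * of_real (x powr (1 + a))
          + of_real (bernoulli (2 * m)) * zeta (of_real (- a)) * zeta (of_nat (2 * m * s))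
             / zeta (of_nat s) ^ 2)) \<le> C * x powr a)
     \<and>
    (\<exists>C. \<forall>x>1. cmod (of_real (H s (2 * m) x (psi (real s + a)))
       - (of_real (bernoulli (2 * m)) * zeta (of_real (2 * real m * real s + a + 1))
             / ((1 + of_real a) * zeta (of_real (2 * real s + 2 * a + 2))) * of_real (x powr (1 + a))
          + of_real (bernoulli (2 * m)) * zeta (of_real (- a)) * zeta (of_nat (2 * m * s))
             / zeta (of_nat (2 * s)))) \<le> C * x powr a)"
proof -
  have zeta_of_nat: "zeta (of_nat n) = of_real (rzeta (real n))" if "n \<ge> 2" for n
    using zeta_of_real_gt_1[of "real n"] that by simp
  have ms: "2 * m * s \<ge> 2" "2 * real m * real s \<ge> 2"
  proof -
    have "2 * 1 * 1 \<le> 2 * m * s"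
      using assms by (intro mult_mono) auto
    thus "2 * m * s \<ge> 2"
      by simp
    hence "real (2 * m * s) \<ge> real 2"
      by (simp only: of_nat_le_iff)
    thus "2 * real m * real s \<ge> 2"
      by simp
  qed
  have zetas: "zeta (of_real (real s + a + 1)) = of_real (rzeta (real s + a + 1))"
      "zeta (of_real (2 * real s + 2 * a + 2)) = of_real (rzeta (2 * (real s + a + 1)))"
      "zeta (of_real (2 * real m * real s + a + 1)) = of_real (rzeta (real (2 * m * s) + a + 1))"
      "zeta (of_real (- a)) = of_real (rzeta (- a))"
      "zeta (of_nat s) = of_real (rzeta (real s))"
      "zeta (of_nat (2 * s)) = of_real (rzeta (2 * real s))"
      "zeta (of_nat (2 * m * s)) = of_real (rzeta (real (2 * m * s)))"
    using zeta_of_real_gt_1[of "real s + a + 1"] zeta_of_real_gt_1[of "2 * real s + 2 * a + 2"]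
      zeta_of_real_gt_1[of "2 * real m * real s + a + 1"] sum_powr_approx(1)[of a]
      zeta_of_nat[of s] zeta_of_nat[of "2 * s"] zeta_of_nat[of "2 * m * s"] assms ms
    by (simp_all add: distrib_left)
  have pos: "rzeta (real s + a + 1) \<noteq> 0" "rzeta (real s) \<noteq> 0"
    using rzeta_pos[of "real s + a + 1"] rzeta_pos[of "real s"] assms by auto
  have phi: "phi b = dirichlet_conv (id_pow b) moebius_mu"
    and psi: "psi b = dirichlet_conv (id_pow b) (\<lambda>n. \<bar>moebius_mu n\<bar>)" for b
    by (simp_all add: phi_def psi_def)
  have nz: "1 + a \<noteq> 0" "1 + complex_of_real a \<noteq> 0" "2 + 2 * complex_of_real a \<noteq> 0"
    using assms by (auto simp: complex_eq_iff)
  \<comment> \<open>The index of the Bernoulli polynomial stays open here, to be taken as 1 and as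
    \<open>2 * m\<close>.\<close>
  note phi_asymp = H_asymp[OF assms(1) _ assms(3,4) has_sum_moebius_mu]
  note psi_asymp = H_asymp[OF assms(1) _ assms(3,4) has_sum_abs_moebius_mu]
  show ?thesis
    unfolding phi psi zetas
  proof (intro conjI, goal_cases)
    case 1
    \<comment> \<open>At index 1 the factor \<open>rzeta (m * s + a + 1)\<close> cancels against
      \<open>1 / rzeta (s + a + 1)\<close>, and likewise at \<open>s\<close>; what remains is the
      Dirichlet series of the Moebius function times \<open>bernoulli 1\<close>.\<close>
    show ?case
      by (rule cmod_approx_of_realI[OF phi_asymp]; (unfold bernoulli_1)?)
         (use pos nz in \<open>auto simp: divide_simps\<close>, (simp add: algebra_simps)?)
  next
    case 2
    show ?case
      by (rule cmod_approx_of_realI[OF psi_asymp]; (unfold bernoulli_1)?)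
         (use pos nz in \<open>auto simp: divide_simps\<close>, (simp add: algebra_simps)?)
  next
    case 3
    show ?case
      by (rule cmod_approx_of_realI[OF phi_asymp])
         (use assms pos in \<open>simp_all add: algebra_simps power2_eq_square\<close>)
  next
    case 4
    show ?case
      by (rule cmod_approx_of_realI[OF psi_asymp])
         (use assms pos in \<open>simp_all add: algebra_simps\<close>)
  qed
qed

end
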